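(* Let $D$ be the Dynkin diagram of the rank 4 hyperbolic Kac-Moody algebra with vertices $1,2,3,4$ and single edges $1-2$, $2-3$, $1-3$, $2-4$ (a triangle $1,2,3$ with vertex $4$ attached to $2$). The equivalence classes of nonempty paintings of $D$ are given by (a) $(1)\sim(3)\sim(4)$; (b) $(2)$. That is, $(1),(3),(4)$ are equivalent, $(2)$ is not equivalent to them, and every nonempty painting is equivalent to one of these.
   Context: A painting of a Dynkin diagram is a choice of a subset of its vertices, called painted (a Vogan diagram with trivial diagram involution). The painting whose painted vertices are exactly $i_1,\dots,i_k$ is denoted $(i_1,\dots,i_k)$. For a painted vertex $i$, the operation $F\langle i\rangle$ (reflection in the noncompact simple root $i$) keeps the color of $i$ and of all vertices not adjacent to $i$ and, the diagram being simply laced, reverses the colors of all vertices adjacent to $i$. Equivalence $\sim$ of paintings is the equivalence relation generated by all operations $F\langle i\rangle$ ($i$ painted) and by automorphisms of the Dynkin diagram. *)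

theory Defs
  imports Main
begin

(* A simply laced Dynkin diagram is given by its vertex set V and its set E of
   edges; an edge is a two-element set {u, v}. *)

definition neighbours :: "'v set \<Rightarrow> 'v set set \<Rightarrow> 'v \<Rightarrow> 'v set" where
  "neighbours V E i = {j \<in> V. {i, j} \<in> E}"

definition diagram_automorphism :: "'v set \<Rightarrow> 'v set set \<Rightarrow> ('v \<Rightarrow> 'v) \<Rightarrow> bool" where
  "diagram_automorphism V E f \<longleftrightarrow>
     bij_betw f V V \<and> (\<forall>u\<in>V. \<forall>v\<in>V. {f u, f v} \<in> E \<longleftrightarrow> {u, v} \<in> E)"

(* A painting is identified with the set P of its painted vertices. *)

definition painting :: "'v set \<Rightarrow> 'v set \<Rightarrow> bool" where
  "painting V P \<longleftrightarrow> P \<subseteq> V"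

definition reflect_painting :: "'v set \<Rightarrow> 'v set set \<Rightarrow> 'v \<Rightarrow> 'v set \<Rightarrow> 'v set" where
  "reflect_painting V E i P =
     {j \<in> V. if j \<in> neighbours V E i then j \<notin> P else j \<in> P}"

inductive painting_step :: "'v set \<Rightarrow> 'v set set \<Rightarrow> 'v set \<Rightarrow> 'v set \<Rightarrow> bool"
  for V E where
  reflect: "painting V P \<Longrightarrow> i \<in> P \<Longrightarrow> painting_step V E P (reflect_painting V E i P)"
| automorphism: "painting V P \<Longrightarrow> diagram_automorphism V E f \<Longrightarrow> painting_step V E P (f ` P)"

(* Sets that are not paintings are equivalent only to themselves. *)

definition painting_equiv :: "'v set \<Rightarrow> 'v set set \<Rightarrow> 'v set \<Rightarrow> 'v set \<Rightarrow> bool" where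
  "painting_equiv V E = equivclp (painting_step V E)"

definition D_vertices :: "nat set" where
  "D_vertices = {1, 2, 3, 4}"

definition D_edges :: "nat set set" where
  "D_edges = {{1, 2}, {2, 3}, {1, 3}, {2, 4}}"

abbreviation D_equiv :: "nat set \<Rightarrow> nat set \<Rightarrow> bool" (infix \<open>\<sim>\<^sub>D\<close> 50) where
  "P \<sim>\<^sub>D Q \<equiv> painting_equiv D_vertices D_edges P Q"

end

(* Every nonempty painting is joined by reflections to (1) or to (2). The classes are separated by
   a set of five paintings containing (1), (3) and (4) but not (2): it is stable under all
   reflections, and under diagram automorphisms since these fix 2 and 4 and permute 1 and 3. *)
theory Submission
  imports Defs
begin

declare One_nat_def [simp del]

lemma reflect_painting_eq:
  assumes "painting V P"
  shows "reflect_painting V E i P = (P - neighbours V E i) \<union> (neighbours V E i - P)"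
  using assms by (auto simp: reflect_painting_def painting_def neighbours_def)

lemma painting_equiv_sym:
  "painting_equiv V E P Q \<Longrightarrow> painting_equiv V E Q P"
  unfolding painting_equiv_def by (rule equivclp_sym)

lemma painting_equiv_trans:
  "painting_equiv V E P Q \<Longrightarrow> painting_equiv V E Q R \<Longrightarrow> painting_equiv V E P R"
  unfolding painting_equiv_def by (rule equivclp_trans)

lemma painting_equiv_refl: "painting_equiv V E P P"
  unfolding painting_equiv_def by simp

lemma painting_equiv_reflect:
  assumes "painting V P" and "i \<in> P"
    and "(P - neighbours V E i) \<union> (neighbours V E i - P) = Q"
  shows "painting_equiv V E P Q"
proof -
  have "painting_step V E P Q"
    using painting_step.reflect[OF assms(1,2), of E] assms by (simp add: reflect_painting_eq)
  then show ?thesis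
    unfolding painting_equiv_def by (rule r_into_equivclp)
qed

text \<open>An equivalence may traverse steps backwards, so \<open>I\<close> has to be preserved in
  both directions; hence the iff.\<close>

lemma painting_equiv_invariant:
  assumes "painting_equiv V E P Q"
    and "\<And>P Q. painting_step V E P Q \<Longrightarrow> I P \<longleftrightarrow> I Q"
  shows "I P \<longleftrightarrow> I Q"
  using assms(1) unfolding painting_equiv_def
  by (induction rule: equivclp_induct) (use assms(2) in blast)+

lemma neighbours_D:
  "neighbours D_vertices D_edges 1 = {2, 3}"
  "neighbours D_vertices D_edges 2 = {1, 3, 4}"
  "neighbours D_vertices D_edges 3 = {1, 2}"
  "neighbours D_vertices D_edges 4 = {2}"
  by (auto simp: neighbours_def D_vertices_def D_edges_def doubleton_eq_iff)

text \<open>Automorphisms preserve adjacency and non-adjacency: 4 is fixed because it alone misses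
  two other vertices, 2 is fixed as the only neighbour of 4, and 1 and 3 are what remains.\<close>

lemma diagram_automorphism_D:
  assumes "diagram_automorphism D_vertices D_edges f"
  shows "f 2 = 2" and "f 4 = 4" and "{f 1, f 3} = {1, 3}"
proof -
  have inj: "inj_on f {1, 2, 3, 4}" and img: "f ` {1, 2, 3, 4} = {1, 2, 3, 4}"
    using assms by (simp_all only: diagram_automorphism_def D_vertices_def bij_betw_def)
  have edge: "{f u, f v} \<in> D_edges \<longleftrightarrow> {u, v} \<in> D_edges"
    if "u \<in> {1, 2, 3, 4}" "v \<in> {1, 2, 3, 4}" for u v
    using assms that unfolding diagram_automorphism_def D_vertices_def by blast
  have range: "f u \<in> {1, 2, 3, 4}" if "u \<in> {1, 2, 3, 4}" for u
    using imageI[OF that, of f] unfolding img .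
  have dist: "f 1 \<noteq> f 2" "f 1 \<noteq> f 3" "f 1 \<noteq> f 4" "f 2 \<noteq> f 3" "f 2 \<noteq> f 4" "f 3 \<noteq> f 4"
    using inj by (simp_all add: inj_on_def)
  have edges: "{f 1, f 4} \<notin> D_edges" "{f 3, f 4} \<notin> D_edges" "{f 2, f 4} \<in> D_edges"
    using edge[of 1 4] edge[of 3 4] edge[of 2 4] by (simp_all add: D_edges_def doubleton_eq_iff)
  \<comment> \<open>Vertex 4 is the only one with two distinct non-neighbours.\<close>
  have non_neighbour: "x = 4" if "x \<in> {1, 2, 3, 4}" "y \<in> {1, 2, 3}" "x \<noteq> y" "{x, y} \<notin> D_edges" for x y
    using that by (elim insertE emptyE; simp add: D_edges_def doubleton_eq_iff)
  have f4: "f 4 = 4"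
  proof (rule ccontr)
    assume "f 4 \<noteq> 4"
    then have "f 4 \<in> {1, 2, 3}"
      using range[of 4] by simp
    \<comment> \<open>1, 2, 3 form a triangle, so a vertex distinct from and not adjacent to one of
      them is 4. This would apply to both \<open>f 1\<close> and \<open>f 3\<close>, against
      injectivity.\<close>
    then have "f 1 = 4" "f 3 = 4"
      using non_neighbour[of "f 1" "f 4"] non_neighbour[of "f 3" "f 4"] range[of 1] range[of 3] dist edges
      by simp_all
    with dist show False by simp
  qed
  have f2: "f 2 = 2"
    using edges(3) unfolding f4 by (simp add: D_edges_def doubleton_eq_iff)
  have "f 1 \<in> {1, 3}" "f 3 \<in> {1, 3}"
    using range[of 1] range[of 3] dist unfolding f2 f4 by simp_all
  then have "{f 1, f 3} = {1, 3}"
    using dist(2) by (elim insertE emptyE) (simp_all add: insert_commute)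
  with f2 f4 show "f 2 = 2" and "f 4 = 4" and "{f 1, f 3} = {1, 3}" by simp_all
qed

lemma painting_D_cases:
  assumes "painting D_vertices P"
  shows "P \<in> {{}, {1}, {2}, {3}, {4}, {1, 2}, {1, 3}, {1, 4}, {2, 3}, {2, 4}, {3, 4},
    {1, 2, 3}, {1, 2, 4}, {1, 3, 4}, {2, 3, 4}, {1, 2, 3, 4}}"
proof -
  have "P \<in> Pow {1, 2, 3, 4}"
    using assms by (simp add: painting_def D_vertices_def)
  then show ?thesis
    unfolding Pow_insert Pow_empty by (elim UnE imageE; simp add: insert_commute)
qed

text \<open>Among the paintings of the diagram, those satisfying the following predicate are exactly
  $(1)$, $(3)$, $(4)$, $(2,4)$ and $(1,2,3)$.\<close>
definition D_class :: "nat set \<Rightarrow> bool" where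
  "D_class P \<longleftrightarrow>
    (if 2 \<in> P then (1 \<in> P \<longleftrightarrow> 3 \<in> P) \<and> (1 \<in> P \<longleftrightarrow> 4 \<notin> P)
     else 1 \<in> P \<and> 3 \<notin> P \<and> 4 \<notin> P \<or> 1 \<notin> P \<and> 3 \<in> P \<and> 4 \<notin> P \<or> 1 \<notin> P \<and> 3 \<notin> P \<and> 4 \<in> P)"

text \<open>A reflection keeps its vertex painted and is thus undone by repeating it, so no painting
  enters or leaves the class; the proof checks each vertex directly. Automorphisms preserve the
  class because \<open>D_class\<close> is symmetric in 1 and 3.\<close>

lemma painting_step_D_class:
  assumes "painting_step D_vertices D_edges P Q"
  shows "D_class P \<longleftrightarrow> D_class Q"
  using assms
proof cases
  case (reflect i)
  then have "i \<in> {1, 2, 3, 4}"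
    using reflect by (auto simp: painting_def D_vertices_def)
  then show ?thesis
    using reflect unfolding D_class_def
    by (auto simp: reflect_painting_eq neighbours_D)
next
  case (automorphism f)
  note f = diagram_automorphism_D[OF automorphism(3)]
  have "f 1 = 1 \<and> f 3 = 3 \<or> f 1 = 3 \<and> f 3 = 1"
    using f(3) by (auto simp: doubleton_eq_iff)
  moreover have "P \<subseteq> {1, 2, 3, 4}"
    using automorphism by (simp add: painting_def D_vertices_def)
  \<comment> \<open>Describing the image vertex by vertex makes both cases, identity and swap of 1
    and 3, propositional.\<close>
  then have "j \<in> Q \<longleftrightarrow> (1 \<in> P \<and> j = f 1) \<or> (2 \<in> P \<and> j = 2) \<or> (3 \<in> P \<and> j = f 3) \<or> (4 \<in> P \<and> j = 4)" for j
    unfolding automorphism(1) using f(1,2) by (auto simp: image_iff)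
  ultimately show ?thesis
    unfolding D_class_def by auto
qed

text \<open>Grows a tree of paintings rooted at \<open>R\<close>: each use adds the painting one
  reflection away from a painting already reached.\<close>

lemma D_equiv_reflect:
  assumes "Q \<sim>\<^sub>D R" and "i \<in> Q" and "Q \<subseteq> {1, 2, 3, 4}"
    and "(Q - neighbours D_vertices D_edges i) \<union> (neighbours D_vertices D_edges i - Q) = P"
  shows "P \<sim>\<^sub>D R"
proof -
  have "Q \<sim>\<^sub>D P"
    using assms by (intro painting_equiv_reflect[of _ _ i]) (auto simp: painting_def D_vertices_def)
  then show ?thesis
    using assms(1) by (rule painting_equiv_trans[OF painting_equiv_sym])
qed

text \<open>The tree rooted at (1) passes through (1,2,3), which branches to (3) and (2,4); the
  latter leads to (4).\<close>

lemma D_equiv_1: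
  "{1, 2, 3} \<sim>\<^sub>D {1}" "{3} \<sim>\<^sub>D {1}" "{2, 4} \<sim>\<^sub>D {1}" "{4} \<sim>\<^sub>D {1}"
proof -
  show 1: "{1, 2, 3} \<sim>\<^sub>D {1}"
    by (rule D_equiv_reflect[OF painting_equiv_refl, of 1]) (auto simp: neighbours_D)
  show "{3} \<sim>\<^sub>D {1}"
    by (rule D_equiv_reflect[OF 1, of 3]) (auto simp: neighbours_D)
  show 2: "{2, 4} \<sim>\<^sub>D {1}"
    by (rule D_equiv_reflect[OF 1, of 2]) (auto simp: neighbours_D)
  show "{4} \<sim>\<^sub>D {1}"
    by (rule D_equiv_reflect[OF 2, of 4]) (auto simp: neighbours_D)
qed

text \<open>These are all the nonempty paintings outside \<open>D_class\<close> other than the root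
  (2), whose reflection paints the whole diagram.\<close>

lemma D_equiv_2:
  "{1, 2, 3, 4} \<sim>\<^sub>D {2}" "{1, 4} \<sim>\<^sub>D {2}" "{3, 4} \<sim>\<^sub>D {2}" "{1, 3, 4} \<sim>\<^sub>D {2}" "{1, 2, 4} \<sim>\<^sub>D {2}"
  "{2, 3} \<sim>\<^sub>D {2}" "{1, 3} \<sim>\<^sub>D {2}" "{1, 2} \<sim>\<^sub>D {2}" "{2, 3, 4} \<sim>\<^sub>D {2}"
proof -
  show 1: "{1, 2, 3, 4} \<sim>\<^sub>D {2}"
    by (rule D_equiv_reflect[OF painting_equiv_refl, of 2]) (auto simp: neighbours_D)
  show 2: "{1, 4} \<sim>\<^sub>D {2}"
    by (rule D_equiv_reflect[OF 1, of 1]) (auto simp: neighbours_D)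
  show "{3, 4} \<sim>\<^sub>D {2}"
    by (rule D_equiv_reflect[OF 1, of 3]) (auto simp: neighbours_D)
  show "{1, 3, 4} \<sim>\<^sub>D {2}"
    by (rule D_equiv_reflect[OF 1, of 4]) (auto simp: neighbours_D)
  show 3: "{1, 2, 4} \<sim>\<^sub>D {2}"
    by (rule D_equiv_reflect[OF 2, of 4]) (auto simp: neighbours_D)
  show 4: "{2, 3} \<sim>\<^sub>D {2}"
    by (rule D_equiv_reflect[OF 3, of 2]) (auto simp: neighbours_D)
  show 5: "{1, 3} \<sim>\<^sub>D {2}"
    by (rule D_equiv_reflect[OF 4, of 3]) (auto simp: neighbours_D)
  show 6: "{1, 2} \<sim>\<^sub>D {2}"
    by (rule D_equiv_reflect[OF 5, of 1]) (auto simp: neighbours_D)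
  show "{2, 3, 4} \<sim>\<^sub>D {2}"
    by (rule D_equiv_reflect[OF 6, of 2]) (auto simp: neighbours_D)
qed

theorem proposition5p10:
  shows "{1} \<sim>\<^sub>D {3} \<and> {3} \<sim>\<^sub>D {4}
    \<and> \<not> {2} \<sim>\<^sub>D {1} \<and> \<not> {2} \<sim>\<^sub>D {3} \<and> \<not> {2} \<sim>\<^sub>D {4}
    \<and> (\<forall>P. painting D_vertices P \<and> P \<noteq> {} \<longrightarrow> P \<sim>\<^sub>D {1} \<or> P \<sim>\<^sub>D {2})"
proof -
  have "\<not> D_class {2}" and in_class: "D_class {1}" "D_class {3}" "D_class {4}"
    by (simp_all add: D_class_def)
  then have "\<not> {2} \<sim>\<^sub>D Q" if "D_class Q" for Q
    using that painting_equiv_invariant[where I = D_class, OF _ painting_step_D_class] by blast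
  moreover have "P \<sim>\<^sub>D {1} \<or> P \<sim>\<^sub>D {2}" if "painting D_vertices P" "P \<noteq> {}" for P
    using painting_D_cases[OF that(1)] that(2) D_equiv_1 D_equiv_2
    \<comment> \<open>The fifteen nonempty paintings split into five reached from (1) and ten from
      (2), counting the roots.\<close>
    by (elim insertE emptyE) (simp_all add: painting_equiv_refl)
  moreover have "{1} \<sim>\<^sub>D {3}"
    using D_equiv_1(2) by (rule painting_equiv_sym)
  moreover have "{3} \<sim>\<^sub>D {4}"
    using D_equiv_1(2) painting_equiv_sym[OF D_equiv_1(4)] by (rule painting_equiv_trans)
  ultimately show ?thesis
    using in_class by simp
qed

end
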